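(* Let $X$ be a treatment variable with $m$ values $x_1,\dots,x_m$ and $Y$ an effect variable with $n$ values $y_1,\dots,y_n$ in a structural causal model. Let $k\ge 2$, let $1\le i_1,\dots,i_k,q\le n$, and let $1\le j_1,\dots,j_k\le m$ be pairwise distinct. Put $S=\{(i_1,j_1),\dots,(i_k,j_k)\}$, $S_{-t}=S\setminus\{(i_t,j_t)\}$ and $J=\{j_1,\dots,j_k\}$. With the quantities $L(\cdot),U(\cdot),L(\cdot\,;p,q),U(\cdot\,;p,q)$ and $\ell(i,j;q),u(i,j;q)$ defined in the context, the probability $P(Y_{x_{j_1}}=y_{i_1},\dots,Y_{x_{j_k}}=y_{i_k},Y=y_q)$ is at least the maximum of the four quantities (1) $0$; (2) $\sum_{t=1}^{k}P(Y_{x_{j_t}}=y_{i_t})+P(Y=y_q)-k$; (3) $\max_{1\le t\le k}\big(L(S_{-t})+\ell(i_t,j_t;q)-1\big)$; (4) $\sum_{1\le r\le k,\ i_r=q}L(S_{-r};j_r,i_r)+\sum_{1\le p\le m,\ p\notin J}L(S;p,q)$; and at most the minimum of the five quantities (1') $\min_{1\le t\le k}P(Y_{x_{j_t}}=y_{i_t})$; (2') $P(Y=y_q)$; (3') $\min_{1\le t\le k}U(S_{-t})$; (4') $\min_{1\le t\le k}u(i_t,j_t;q)$; (5') $\sum_{1\le r\le k,\ i_r=q}U(S_{-r};j_r,i_r)+\sum_{1\le p\le m,\ p\notin J}U(S;p,q)$.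
   Context: Setting. $Y_{x_j}$ denotes the counterfactual (potential outcome) variable "the value $Y$ would have, had $X$ been $x_j$". The structural causal model induces one probability space $P$ on which $X$, $Y$, and $Y_{x_1},\dots,Y_{x_m}$ (each with values in $\{y_1,\dots,y_n\}$) are jointly defined, and they satisfy consistency: on the event $X=x_j$ one has $Y_{x_j}=Y$. The values $x_1,\dots,x_m$ are distinct, as are $y_1,\dots,y_n$. Bounds $\ell,u$ used for $P(Y_{x_j}=y_i,Y=y_q)$. With $a=P(Y_{x_j}=y_i)$, $P(x_p,y_q)=P(X=x_p,Y=y_q)$, $P(x_p)=P(X=x_p)$, $P(y_q)=P(Y=y_q)$: if $i=q$: $\ell(i,j;q)=\max\{P(x_j,y_i),\ a+P(y_i)-1\}$ and $u(i,j;q)=\min\{a,\ P(y_i)\}$; if $i\ne q$: $\ell(i,j;q)=\max\{0,\ a+P(y_q)-1,\ \sum_{1\le p\le m,\,p\ne j}\max\{0,\ a+P(x_p,y_q)-1+P(x_j)-P(x_j,y_i)\}\}$ and $u(i,j;q)=\min\{a-P(x_j,y_i),\ P(y_q)-P(x_j,y_q)\}$. Recursive bounds. Throughout, $S=\{(i_1,j_1),\dots,(i_k,j_k)\}$ with $k\ge1$, $1\le i_t\le n$, $1\le j_t\le m$ and $j_1,\dots,j_k$ pairwise distinct; $J=\{j_1,\dots,j_k\}$; $S_{-t}=S\setminus\{(i_t,j_t)\}$; $S_t=\{(i_t,j_t)\}$; $1\le p\le m$ with $p\notin J$; $1\le q\le n$. Write $a_t=P(Y_{x_{j_t}}=y_{i_t})$.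 $L(S),U(S)$ are the lower and upper bounds used for $P(Y_{x_{j_1}}=y_{i_1},\dots,Y_{x_{j_k}}=y_{i_k})$; $L(S;p),U(S;p)$ those used for $P(Y_{x_{j_1}}=y_{i_1},\dots,Y_{x_{j_k}}=y_{i_k},X=x_p)$; $L(S;p,q),U(S;p,q)$ those used for $P(Y_{x_{j_1}}=y_{i_1},\dots,Y_{x_{j_k}}=y_{i_k},X=x_p,Y=y_q)$. They are the following numbers, defined by recursion on $k$. Case $k=1$, $S=\{(i,j)\}$, $a=P(Y_{x_j}=y_i)$: $L(S)=U(S)=a$; $L(S;p)=\max\{0,\ a-P(x_j,y_i)-1+P(x_j)+P(x_p)\}$; $U(S;p)=\min\{a-P(x_j,y_i),\ P(x_p)\}$; $L(S;p,q)=\max\{0,\ a+P(x_p,y_q)-1+P(x_j)-P(x_j,y_i)\}$; $U(S;p,q)=\min\{a-P(x_j,y_i),\ P(x_p,y_q)\}$. Case $k\ge2$: $L(S;p)=\max\{0,\ \sum_{t}a_t+P(x_p)-k,\ \max_{t}(L(S_{-t})+L(S_t;p)-1)\}$; $U(S;p)=\min\{\min_t a_t,\ P(x_p),\ \min_t U(S_{-t}),\ \min_t U(S_t;p)\}$; $L(S;p,q)=\max\{0,\ \sum_{t}a_t+P(x_p,y_q)-k,\ \max_{t}(L(S_{-t})+L(S_t;p,q)-1)\}$; $U(S;p,q)=\min\{\min_t a_t,\ P(x_p,y_q),\ \min_t U(S_{-t}),\ \min_t U(S_t;p,q)\}$; $L(S)=\max\{0,\ \sum_t a_t-k+1,\ \max_t(L(S_{-t})+a_t-1),\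 \sum_{r=1}^kL(S_{-r};j_r,i_r)+\sum_{p\notin J}L(S;p)\}$; $U(S)=\min\{\min_t a_t,\ \min_tU(S_{-t}),\ \sum_{r=1}^kU(S_{-r};j_r,i_r)+\sum_{p\notin J}U(S;p)\}$, where $t$ ranges over $1,\dots,k$ and $p\notin J$ means $p\in\{1,\dots,m\}\setminus J$. *)

theory Defs
  imports "HOL-Probability.Probability"
begin

(* The variables that a structural causal model with treatment X and effect Y induces on its
   probability space.  The treatment values x_1, ..., x_m are xval C 1, ..., xval C m and the
   effect values y_1, ..., y_n are yval C 1, ..., yval C n; cf C x is the counterfactual
   variable Y_x. *)
record ('w, 'x, 'y) counterfactuals =
  meas :: "'w measure"
  num_x :: nat
  num_y :: nat
  xval :: "nat \<Rightarrow> 'x"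
  yval :: "nat \<Rightarrow> 'y"
  treat :: "'w \<Rightarrow> 'x"
  eff :: "'w \<Rightarrow> 'y"
  cf :: "'x \<Rightarrow> 'w \<Rightarrow> 'y"

locale counterfactual_model =
  fixes C :: "('w, 'x, 'y) counterfactuals"
  assumes prob_space_meas: "prob_space (meas C)"
    and inj_xval: "inj_on (xval C) {1..num_x C}"
    and inj_yval: "inj_on (yval C) {1..num_y C}"
    and measurable_treat:
      "treat C \<in> measurable (meas C) (count_space (xval C ` {1..num_x C}))"
    and measurable_eff:
      "eff C \<in> measurable (meas C) (count_space (yval C ` {1..num_y C}))"
    and measurable_cf:
      "\<And>j. j \<in> {1..num_x C} \<Longrightarrow>
        cf C (xval C j) \<in> measurable (meas C) (count_space (yval C ` {1..num_y C}))"
    and consistency: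
      "\<And>j w. j \<in> {1..num_x C} \<Longrightarrow> w \<in> space (meas C) \<Longrightarrow> treat C w = xval C j \<Longrightarrow>
        cf C (xval C j) w = eff C w"

definition pr_x :: "('w, 'x, 'y) counterfactuals \<Rightarrow> nat \<Rightarrow> real" where
  "pr_x C p = \<P>(w in meas C. treat C w = xval C p)"

definition pr_y :: "('w, 'x, 'y) counterfactuals \<Rightarrow> nat \<Rightarrow> real" where
  "pr_y C q = \<P>(w in meas C. eff C w = yval C q)"

definition pr_xy :: "('w, 'x, 'y) counterfactuals \<Rightarrow> nat \<Rightarrow> nat \<Rightarrow> real" where
  "pr_xy C p q = \<P>(w in meas C. treat C w = xval C p \<and> eff C w = yval C q)"

(* pr_cf C i j is P(Y_{x_j} = y_i): the index of the effect value comes first. *)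
definition pr_cf :: "('w, 'x, 'y) counterfactuals \<Rightarrow> nat \<Rightarrow> nat \<Rightarrow> real" where
  "pr_cf C i j = \<P>(w in meas C. cf C (xval C j) w = yval C i)"

(* The bounds l(i,j;q) and u(i,j;q) for P(Y_{x_j} = y_i, Y = y_q). *)
definition lower_cf_y :: "('w, 'x, 'y) counterfactuals \<Rightarrow> nat \<Rightarrow> nat \<Rightarrow> nat \<Rightarrow> real" where
  "lower_cf_y C i j q =
    (if i = q then max (pr_xy C j i) (pr_cf C i j + pr_y C i - 1)
     else Max {0,
       pr_cf C i j + pr_y C q - 1,
       \<Sum>p\<in>{1..num_x C} - {j}.
         max 0 (pr_cf C i j + pr_xy C p q - 1 + pr_x C j - pr_xy C j i)})"

definition upper_cf_y :: "('w, 'x, 'y) counterfactuals \<Rightarrow> nat \<Rightarrow> nat \<Rightarrow> nat \<Rightarrow> real" where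
  "upper_cf_y C i j q =
    (if i = q then min (pr_cf C i j) (pr_y C i)
     else min (pr_cf C i j - pr_xy C j i) (pr_y C q - pr_xy C j q))"

(* The recursive bounds.  A set S of index pairs (i, j) stands for the event that Y_{x_j} = y_i
   for all (i, j) in S; lower C S is L(S), lower_x C S p is L(S;p), lower_xy C S p q is
   L(S;p,q), and similarly for U.  The else branches are the base case of a singleton S; the
   values at empty and at infinite S are irrelevant. *)
function (sequential)
  lower :: "('w, 'x, 'y) counterfactuals \<Rightarrow> (nat \<times> nat) set \<Rightarrow> real" and
  lower_x :: "('w, 'x, 'y) counterfactuals \<Rightarrow> (nat \<times> nat) set \<Rightarrow> nat \<Rightarrow> real" and
  lower_xy :: "('w, 'x, 'y) counterfactuals \<Rightarrow> (nat \<times> nat) set \<Rightarrow> nat \<Rightarrow> nat \<Rightarrow> real"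
where
  "lower C S =
    (if finite S \<and> 2 \<le> card S then
       Max {0,
         (\<Sum>(i, j)\<in>S. pr_cf C i j) - real (card S) + 1,
         MAX t\<in>S. lower C (S - {t}) + pr_cf C (fst t) (snd t) - 1,
         (\<Sum>r\<in>S. lower_xy C (S - {r}) (snd r) (fst r)) +
           (\<Sum>p\<in>{1..num_x C} - snd ` S. lower_x C S p)}
     else (let (i, j) = the_elem S in pr_cf C i j))"
| "lower_x C S p =
    (if finite S \<and> 2 \<le> card S then
       Max {0,
         (\<Sum>(i, j)\<in>S. pr_cf C i j) + pr_x C p - real (card S),
         MAX t\<in>S. lower C (S - {t}) + lower_x C {t} p - 1}
     else (let (i, j) = the_elem S in
       max 0 (pr_cf C i j - pr_xy C j i - 1 + pr_x C j + pr_x C p)))"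
| "lower_xy C S p q =
    (if finite S \<and> 2 \<le> card S then
       Max {0,
         (\<Sum>(i, j)\<in>S. pr_cf C i j) + pr_xy C p q - real (card S),
         MAX t\<in>S. lower C (S - {t}) + lower_xy C {t} p q - 1}
     else (let (i, j) = the_elem S in
       max 0 (pr_cf C i j + pr_xy C p q - 1 + pr_x C j - pr_xy C j i)))"
  by pat_completeness auto
termination
  by (relation "Wellfounded.measure (\<lambda>a. case a of
        Inl (C, S) \<Rightarrow> 2 * card S + 1
      | Inr (Inl (C, S, p)) \<Rightarrow> 2 * card S
      | Inr (Inr (C, S, p, q)) \<Rightarrow> 2 * card S)")
     (auto simp: card_Diff_singleton)

function (sequential)
  upper :: "('w, 'x, 'y) counterfactuals \<Rightarrow> (nat \<times> nat) set \<Rightarrow> real" and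
  upper_x :: "('w, 'x, 'y) counterfactuals \<Rightarrow> (nat \<times> nat) set \<Rightarrow> nat \<Rightarrow> real" and
  upper_xy :: "('w, 'x, 'y) counterfactuals \<Rightarrow> (nat \<times> nat) set \<Rightarrow> nat \<Rightarrow> nat \<Rightarrow> real"
where
  "upper C S =
    (if finite S \<and> 2 \<le> card S then
       Min {MIN (i, j)\<in>S. pr_cf C i j,
         MIN t\<in>S. upper C (S - {t}),
         (\<Sum>r\<in>S. upper_xy C (S - {r}) (snd r) (fst r)) +
           (\<Sum>p\<in>{1..num_x C} - snd ` S. upper_x C S p)}
     else (let (i, j) = the_elem S in pr_cf C i j))"
| "upper_x C S p =
    (if finite S \<and> 2 \<le> card S then
       Min {MIN (i, j)\<in>S. pr_cf C i j,
         pr_x C p,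
         MIN t\<in>S. upper C (S - {t}),
         MIN t\<in>S. upper_x C {t} p}
     else (let (i, j) = the_elem S in min (pr_cf C i j - pr_xy C j i) (pr_x C p)))"
| "upper_xy C S p q =
    (if finite S \<and> 2 \<le> card S then
       Min {MIN (i, j)\<in>S. pr_cf C i j,
         pr_xy C p q,
         MIN t\<in>S. upper C (S - {t}),
         MIN t\<in>S. upper_xy C {t} p q}
     else (let (i, j) = the_elem S in min (pr_cf C i j - pr_xy C j i) (pr_xy C p q)))"
  by pat_completeness auto
termination
  by (relation "Wellfounded.measure (\<lambda>a. case a of
        Inl (C, S) \<Rightarrow> 2 * card S + 1
      | Inr (Inl (C, S, p)) \<Rightarrow> 2 * card S
      | Inr (Inr (C, S, p, q)) \<Rightarrow> 2 * card S)")
     (auto simp: card_Diff_singleton)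

end

theory Submission
  imports Defs
begin

text \<open>
  Every bound follows from the Bonferroni inequality, from monotonicity, or from the decomposition
  over the values of the treatment.  On the event X = x_{j_r} consistency turns the condition
  Y_{x_{j_r}} = y_{i_r} into Y = y_{i_r}, so that the pair r can be removed from S there; this is
  what makes the recursion run.  The bounds for a single pair with X = x_p come from the
  Bonferroni inequality relative to the event that X differs from x_j.
\<close>

text \<open>The defining equations match every set S, so they are kept out of the simplifier and
  invoked explicitly; this leaves the recursive calls folded for use with the induction
  hypotheses.\<close>

lemmas [simp del] =
  lower.simps lower_x.simps lower_xy.simps upper.simps upper_x.simps upper_xy.simps

section \<open>Bonferroni inequalities\<close>

lemma (in prob_space) prob_Int_ge:
  assumes "A \<in> events" "B \<in> events" "D \<in> events" "A \<subseteq> D" "B \<subseteq> D"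
  shows "prob A + prob B - prob D \<le> prob (A \<inter> B)"
proof -
  have "prob (A \<union> B) = prob A + prob B - prob (A \<inter> B)"
    using assms measure_Un3[of A M B] by (simp add: fmeasurable_eq_sets)
  \<comment> \<open>Bounding the union by D instead of the whole space is the gain: a smaller D
    gives a sharper inequality, and D = \<open>space M\<close> gives the usual one.\<close>
  moreover have "prob (A \<union> B) \<le> prob D"
    using assms by (intro finite_measure_mono) auto
  ultimately show ?thesis by linarith
qed

text \<open>Starting from B, each further event costs its complement, that is
  \<open>1 - prob (A t)\<close>. Writing the event as a subset of B makes the empty case equal to B
  itself.\<close>

lemma (in prob_space) prob_INT_Int_ge:
  assumes "finite S" "\<And>t. t \<in> S \<Longrightarrow> A t \<in> events" "B \<in> events"
  shows "(\<Sum>t\<in>S. prob (A t)) + prob B - real (card S) \<le> prob {w \<in> B. \<forall>t\<in>S. w \<in> A t}"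
  using assms
proof (induction S)
  case empty
  then show ?case by simp
next
  case (insert s S)
  let ?E = "{w \<in> B. \<forall>t\<in>S. w \<in> A t}"
  have "?E = B \<inter> (\<Inter>t\<in>S. A t) \<inter> space M"
    using sets.sets_into_space[OF insert.prems(2)] by auto
  also have "\<dots> \<in> events"
    \<comment> \<open>The empty family is separated because its intersection is the whole type,
      which in general is not an event.\<close>
    using insert by (cases "S = {}") auto
  finally have "prob ?E + prob (A s) - prob (space M) \<le> prob (?E \<inter> A s)"
    using insert.prems by (intro prob_Int_ge sets.sets_into_space) auto
  moreover have "?E \<inter> A s = {w \<in> B. \<forall>t\<in>insert s S. w \<in> A t}"
    by auto
  ultimately show ?case
    using insert by (simp add: prob_space)
qed

section \<open>Events of the model and admissible index sets\<close>

sublocale counterfactual_model \<subseteq> prob_space "meas C"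
  by (rule prob_space_meas)

context counterfactual_model
begin

definition x_event :: "nat \<Rightarrow> 'w set" where
  "x_event p = {w \<in> space (meas C). treat C w = xval C p}"

definition y_event :: "nat \<Rightarrow> 'w set" where
  "y_event q = {w \<in> space (meas C). eff C w = yval C q}"

definition cf_event :: "(nat \<times> nat) set \<Rightarrow> 'w set" where
  "cf_event S = {w \<in> space (meas C). \<forall>(i, j)\<in>S. cf C (xval C j) w = yval C i}"

text \<open>These are the sets S = {(i_1, j_1), ..., (i_k, j_k)} with k \<ge> 1 of the recursion;
  injectivity of \<open>snd\<close> expresses that the treatment indices are pairwise
  distinct.\<close>

definition admissible :: "(nat \<times> nat) set \<Rightarrow> bool" where
  "admissible S \<longleftrightarrow> S \<noteq> {} \<and> S \<subseteq> {1..num_y C} \<times> {1..num_x C} \<and> inj_on snd S"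

lemma admissible_finite: "admissible S \<Longrightarrow> finite S"
  unfolding admissible_def
  using finite_subset[of S "{1..num_y C} \<times> {1..num_x C}"] by simp

lemma admissible_subset: "admissible S \<Longrightarrow> T \<subseteq> S \<Longrightarrow> T \<noteq> {} \<Longrightarrow> admissible T"
  unfolding admissible_def using inj_on_subset[of snd S T] by blast

lemma admissible_Diff:
  assumes "admissible S" "2 \<le> card S"
  shows "admissible (S - {t})"
proof -
  have "S - {t} \<noteq> {}"
  proof
    assume "S - {t} = {}"
    then have "S \<subseteq> {t}" by auto
    then show False using card_mono[of "{t}" S] assms(2) by simp
  qed
  then show ?thesis by (intro admissible_subset[OF assms(1)]) auto
qed

lemma admissible_singletonE:
  assumes "admissible S" "\<not> 2 \<le> card S"
  obtains t where "S = {t}"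
proof -
  have "card S \<noteq> 0"
    using assms(1) admissible_finite[OF assms(1)] by (simp add: admissible_def)
  then have "card S = 1" using assms(2) by linarith
  then show ?thesis using that card_1_singletonE by blast
qed

text \<open>Makes the treatment index of r legitimate as the index p in the bounds for S - {r} with
  X = x_p, which the recursion calls with p = \<open>snd r\<close>.\<close>

lemma admissible_snd_notin_Diff:
  "admissible S \<Longrightarrow> r \<in> S \<Longrightarrow> snd r \<notin> snd ` (S - {r})"
  unfolding admissible_def inj_on_def by blast

lemma admissible_snd_subset: "admissible S \<Longrightarrow> snd ` S \<subseteq> {1..num_x C}"
  unfolding admissible_def by auto

section \<open>Measurability and consistency\<close>

lemma x_event_in_events: "p \<in> {1..num_x C} \<Longrightarrow> x_event p \<in> events"
  using measurable_sets[OF measurable_treat, of "{xval C p}"]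
  by (simp add: x_event_def vimage_def Int_def conj_commute)

lemma y_event_in_events: "q \<in> {1..num_y C} \<Longrightarrow> y_event q \<in> events"
  using measurable_sets[OF measurable_eff, of "{yval C q}"]
  by (simp add: y_event_def vimage_def Int_def conj_commute)

lemma cf_event_single_in_events:
  assumes "t \<in> {1..num_y C} \<times> {1..num_x C}"
  shows "cf_event {t} \<in> events"
proof -
  obtain i j where t: "t = (i, j)" "i \<in> {1..num_y C}" "j \<in> {1..num_x C}"
    using assms by auto
  then show ?thesis
    using measurable_sets[OF measurable_cf[OF t(3)], of "{yval C i}"]
    by (simp add: cf_event_def vimage_def Int_def conj_commute)
qed

lemma cf_event_in_events:
  assumes "admissible S"
  shows "cf_event S \<in> events"
proof -
  \<comment> \<open>Nonemptiness of S matters: an empty intersection would be the whole type,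
    whereas \<open>cf_event {}\<close> is the sample space.\<close>
  have "cf_event S = (\<Inter>t\<in>S. cf_event {t})"
    using assms by (auto simp: cf_event_def admissible_def)
  also have "\<dots> \<in> events"
    using assms admissible_finite[OF assms]
    by (intro sets.finite_INT cf_event_single_in_events) (auto simp: admissible_def)
  finally show ?thesis .
qed

lemma cf_event_mono: "T \<subseteq> S \<Longrightarrow> cf_event S \<subseteq> cf_event T"
  by (auto simp: cf_event_def)

lemma cf_event_Int_split: "t \<in> S \<Longrightarrow> cf_event S = cf_event (S - {t}) \<inter> cf_event {t}"
  by (auto simp: cf_event_def)

text \<open>Only the factor \<open>cf_event {r}\<close> changes: where X has the value belonging to
  r, the counterfactual of r is Y. This is the one direct use of \<open>consistency\<close>.\<close>

lemma cf_event_Int_x_event: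
  assumes "admissible S" "r \<in> S"
  shows "cf_event S \<inter> x_event (snd r) = cf_event (S - {r}) \<inter> x_event (snd r) \<inter> y_event (fst r)"
proof -
  have "cf_event {r} \<inter> x_event (snd r) = x_event (snd r) \<inter> y_event (fst r)"
    using assms consistency[of "snd r"]
    by (cases r) (auto simp: cf_event_def x_event_def y_event_def admissible_def)
  then show ?thesis
    using cf_event_Int_split[OF assms(2)] by blast
qed

section \<open>Decomposition over the values of the treatment\<close>

lemma y_event_disjoint:
  "i \<in> {1..num_y C} \<Longrightarrow> q \<in> {1..num_y C} \<Longrightarrow> i \<noteq> q \<Longrightarrow> y_event i \<inter> y_event q = {}"
  using inj_onD[OF inj_yval, of i q] by (auto simp: y_event_def)

lemma x_event_disjoint:
  "p \<in> {1..num_x C} \<Longrightarrow> r \<in> {1..num_x C} \<Longrightarrow> p \<noteq> r \<Longrightarrow> x_event p \<inter> x_event r = {}"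
  using inj_onD[OF inj_xval, of p r] by (auto simp: x_event_def)

lemma prob_eq_sum_x_event:
  assumes "A \<in> events"
  shows "prob A = (\<Sum>p\<in>{1..num_x C}. prob (A \<inter> x_event p))"
proof -
  \<comment> \<open>Measurability into the count space on the listed values also says that X takes
    no other value, so the events X = x_p cover the space.\<close>
  have "treat C w \<in> xval C ` {1..num_x C}" if "w \<in> space (meas C)" for w
    using measurable_space[OF measurable_treat that] by simp
  then have "A = (\<Union>p\<in>{1..num_x C}. A \<inter> x_event p)"
    using sets.sets_into_space[OF assms] unfolding x_event_def by blast
  also have "prob \<dots> = (\<Sum>p\<in>{1..num_x C}. prob (A \<inter> x_event p))"
  proof (rule finite_measure_finite_Union)
    show "(\<lambda>p. A \<inter> x_event p) ` {1..num_x C} \<subseteq> events"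
      using assms x_event_in_events by blast
    show "disjoint_family_on (\<lambda>p. A \<inter> x_event p) {1..num_x C}"
      using x_event_disjoint unfolding disjoint_family_on_def by blast
  qed simp
  finally show ?thesis .
qed

lemma sum_x_event_split:
  assumes "admissible S"
  shows "(\<Sum>p\<in>{1..num_x C}. f p) = (\<Sum>r\<in>S. f (snd r)) + (\<Sum>p\<in>{1..num_x C} - snd ` S. (f p :: real))"
proof -
  have "(\<Sum>r\<in>S. f (snd r)) = sum f (snd ` S)"
    using assms by (simp add: sum.reindex admissible_def)
  then show ?thesis
    using sum.subset_diff[OF admissible_snd_subset[OF assms], of f] by simp
qed

text \<open>The exact identity behind the sum entries of \<open>lower\<close> and
  \<open>upper\<close>: replacing each summand by its bound gives those entries.\<close>

lemma prob_cf_event_eq: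
  assumes "admissible S"
  shows "prob (cf_event S) =
    (\<Sum>r\<in>S. prob (cf_event (S - {r}) \<inter> (x_event (snd r) \<inter> y_event (fst r)))) +
    (\<Sum>p\<in>{1..num_x C} - snd ` S. prob (cf_event S \<inter> x_event p))"
  using prob_eq_sum_x_event[OF cf_event_in_events[OF assms]]
    sum_x_event_split[OF assms, of "\<lambda>p. prob (cf_event S \<inter> x_event p)"]
  by (simp add: cf_event_Int_x_event[OF assms] Int_assoc)

text \<open>Where X has the value belonging to r in S, consistency forces Y to be the effect value
  of r. Intersecting with Y = y_q therefore keeps that summand unchanged if \<open>fst r = q\<close>
  and makes it vanish otherwise.\<close>

lemma prob_cf_event_y_event_eq:
  assumes S: "admissible S" and q: "q \<in> {1..num_y C}"
  shows "prob (cf_event S \<inter> y_event q) =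
    (\<Sum>r | r \<in> S \<and> fst r = q. prob (cf_event (S - {r}) \<inter> (x_event (snd r) \<inter> y_event (fst r)))) +
    (\<Sum>p\<in>{1..num_x C} - snd ` S. prob (cf_event S \<inter> (x_event p \<inter> y_event q)))"
proof -
  have "prob (cf_event S \<inter> (x_event (snd r) \<inter> y_event q)) =
      (if fst r = q then prob (cf_event (S - {r}) \<inter> (x_event (snd r) \<inter> y_event (fst r))) else 0)"
      if r: "r \<in> S" for r
  proof -
    have "fst r \<in> {1..num_y C}"
      using S r by (auto simp: admissible_def)
    then have "y_event (fst r) \<inter> y_event q = {}" if "fst r \<noteq> q"
      using y_event_disjoint q that by blast
    moreover have "cf_event S \<inter> (x_event (snd r) \<inter> y_event q) =
        cf_event (S - {r}) \<inter> x_event (snd r) \<inter> (y_event (fst r) \<inter> y_event q)"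
      using cf_event_Int_x_event[OF S r] by blast
    ultimately show ?thesis
      by (simp add: Int_assoc)
  qed
  then have "(\<Sum>r\<in>S. prob (cf_event S \<inter> (x_event (snd r) \<inter> y_event q))) =
      (\<Sum>r | r \<in> S \<and> fst r = q. prob (cf_event (S - {r}) \<inter> (x_event (snd r) \<inter> y_event (fst r))))"
    unfolding sum.inter_filter[OF admissible_finite[OF S]] by (rule sum.cong[OF refl])
  moreover have "cf_event S \<inter> y_event q \<in> events"
    using S q cf_event_in_events y_event_in_events by blast
  from prob_eq_sum_x_event[OF this]
  have "prob (cf_event S \<inter> y_event q) =
      (\<Sum>p\<in>{1..num_x C}. prob (cf_event S \<inter> (x_event p \<inter> y_event q)))"
    by (simp add: Int_ac)
  ultimately show ?thesis
    using sum_x_event_split[OF S, of "\<lambda>p. prob (cf_event S \<inter> (x_event p \<inter> y_event q))"]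
    by simp
qed

section \<open>The given probabilities as events, and general bounds\<close>

lemma pr_x_eq: "pr_x C p = prob (x_event p)"
  by (simp add: pr_x_def x_event_def)

lemma pr_y_eq: "pr_y C q = prob (y_event q)"
  by (simp add: pr_y_def y_event_def)

lemma pr_xy_eq: "pr_xy C p q = prob (x_event p \<inter> y_event q)"
  unfolding pr_xy_def x_event_def y_event_def by (rule arg_cong[where f = prob]) auto

lemma pr_cf_eq: "pr_cf C i j = prob (cf_event {(i, j)})"
  by (simp add: pr_cf_def cf_event_def)

text \<open>B is left arbitrary so that one lemma serves X = x_p, X = x_p with Y = y_q, Y = y_q, and
  the whole space.\<close>

lemma prob_cf_event_Int_ge_sum:
  assumes S: "admissible S" and B: "B \<in> events"
  shows "(\<Sum>(i, j)\<in>S. pr_cf C i j) + prob B - real (card S) \<le> prob (cf_event S \<inter> B)"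
proof -
  have "{w \<in> B. \<forall>t\<in>S. w \<in> cf_event {t}} = cf_event S \<inter> B"
    using sets.sets_into_space[OF B] by (auto simp: cf_event_def)
  moreover have "(\<Sum>(i, j)\<in>S. pr_cf C i j) = (\<Sum>t\<in>S. prob (cf_event {t}))"
    by (simp add: pr_cf_eq case_prod_unfold)
  moreover have "cf_event {t} \<in> events" if "t \<in> S" for t
    using S that cf_event_single_in_events unfolding admissible_def by blast
  ultimately show ?thesis
    using prob_INT_Int_ge[OF admissible_finite[OF S] _ B, of "\<lambda>t. cf_event {t}"] by simp
qed

text \<open>Bonferroni for two events, with B attached to the single pair t, because joint bounds
  with B are available directly for single pairs.\<close>

lemma prob_cf_event_Int_ge_Diff:
  assumes S: "admissible S" "2 \<le> card S" and t: "t \<in> S" and B: "B \<in> events"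
  shows "prob (cf_event (S - {t})) + prob (cf_event {t} \<inter> B) - 1 \<le> prob (cf_event S \<inter> B)"
proof -
  have "cf_event (S - {t}) \<in> events" "cf_event {t} \<inter> B \<in> events"
    using S t B admissible_Diff admissible_subset cf_event_in_events
    by (auto intro!: sets.Int)
  then have "prob (cf_event (S - {t})) + prob (cf_event {t} \<inter> B) - prob (space (meas C))
      \<le> prob (cf_event (S - {t}) \<inter> (cf_event {t} \<inter> B))"
    by (intro prob_Int_ge sets.sets_into_space) auto
  then show ?thesis
    using cf_event_Int_split[OF t] by (simp add: prob_space Int_assoc)
qed

lemma prob_cf_event_Int_le:
  assumes "admissible T" "B \<in> events" "T \<subseteq> S"
  shows "prob (cf_event S \<inter> B) \<le> prob (cf_event T)"
  using assms cf_event_mono[OF assms(3)] cf_event_in_events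
  by (intro finite_measure_mono) auto

lemma prob_cf_event_Int_mono:
  assumes "admissible T" "B \<in> events" "T \<subseteq> S"
  shows "prob (cf_event S \<inter> B) \<le> prob (cf_event T \<inter> B)"
  using assms cf_event_mono[OF assms(3)] cf_event_in_events
  by (intro finite_measure_mono) auto

lemma prob_cf_event_single_off:
  assumes "i \<in> {1..num_y C}" "j \<in> {1..num_x C}"
  shows "prob (cf_event {(i, j)} - x_event j) = pr_cf C i j - pr_xy C j i"
proof -
  have adm: "admissible {(i, j)}"
    using assms by (auto simp: admissible_def)
  \<comment> \<open>Removing the only pair leaves \<open>cf_event {}\<close>, the sample space,
    which disappears from the intersection.\<close>
  have eq: "cf_event {(i, j)} \<inter> x_event j = x_event j \<inter> y_event i"
    using cf_event_Int_x_event[OF adm, of "(i, j)"] by (auto simp: cf_event_def x_event_def)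
  show ?thesis
    using finite_measure_Diff'[OF cf_event_in_events[OF adm] x_event_in_events[OF assms(2)]]
    by (simp add: eq pr_cf_eq pr_xy_eq)
qed

text \<open>Since B misses X = x_j, only the part of the counterfactual event outside X = x_j
  counts, and its probability is known exactly by \<open>prob_cf_event_single_off\<close>.
  Bonferroni is then taken relative to the complement of X = x_j, whose probability is
  \<open>1 - pr_x C j\<close>.\<close>

lemma prob_cf_event_single_Int_bounds:
  assumes ij: "i \<in> {1..num_y C}" "j \<in> {1..num_x C}"
    and B: "B \<in> events" "B \<inter> x_event j = {}"
  shows "max 0 (pr_cf C i j + prob B - 1 + pr_x C j - pr_xy C j i)
      \<le> prob (cf_event {(i, j)} \<inter> B)" (is ?ge)
    and "prob (cf_event {(i, j)} \<inter> B) \<le> min (pr_cf C i j - pr_xy C j i) (prob B)" (is ?le)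
proof -
  let ?A = "cf_event {(i, j)} - x_event j" and ?D = "space (meas C) - x_event j"
  have ev: "?A \<in> events" "?D \<in> events"
    using ij by (auto intro!: sets.Diff cf_event_single_in_events x_event_in_events)
  have eq: "cf_event {(i, j)} \<inter> B = ?A \<inter> B"
    using B(2) by blast
  have "prob ?A + prob B - prob ?D \<le> prob (?A \<inter> B)"
    using ev B sets.sets_into_space[OF B(1)] by (intro prob_Int_ge) (auto simp: cf_event_def)
  moreover have "prob ?D = 1 - pr_x C j"
    using prob_compl[OF x_event_in_events[OF ij(2)]] by (simp add: pr_x_eq)
  ultimately show ?ge
    using eq prob_cf_event_single_off[OF ij] by simp
  have "prob (?A \<inter> B) \<le> prob ?A" "prob (?A \<inter> B) \<le> prob B"
    using ev B by (auto intro!: finite_measure_mono)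
  then show ?le
    using eq prob_cf_event_single_off[OF ij] by simp
qed

section \<open>Joint bounds with X = x_p, and with X = x_p and Y = y_q\<close>

lemma x_event_single_bounds:
  assumes "admissible {t}" "p \<in> {1..num_x C} - {snd t}"
  shows "lower_x C {t} p \<le> prob (cf_event {t} \<inter> x_event p)"
    and "prob (cf_event {t} \<inter> x_event p) \<le> upper_x C {t} p"
proof -
  obtain i j where t: "t = (i, j)" "i \<in> {1..num_y C}" "j \<in> {1..num_x C}"
    using assms(1) by (cases t) (auto simp: admissible_def)
  have "x_event p \<in> events" "x_event p \<inter> x_event j = {}"
    using assms(2) t by (intro x_event_in_events x_event_disjoint; auto)+
  from prob_cf_event_single_Int_bounds[OF t(2,3) this]
  show "lower_x C {t} p \<le> prob (cf_event {t} \<inter> x_event p)"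
    and "prob (cf_event {t} \<inter> x_event p) \<le> upper_x C {t} p"
    by (simp_all add: t(1) lower_x.simps upper_x.simps pr_x_eq algebra_simps)
qed

lemma xy_event_single_bounds:
  assumes "admissible {t}" "p \<in> {1..num_x C} - {snd t}" "q \<in> {1..num_y C}"
  shows "lower_xy C {t} p q \<le> prob (cf_event {t} \<inter> (x_event p \<inter> y_event q))"
    and "prob (cf_event {t} \<inter> (x_event p \<inter> y_event q)) \<le> upper_xy C {t} p q"
proof -
  obtain i j where t: "t = (i, j)" "i \<in> {1..num_y C}" "j \<in> {1..num_x C}"
    using assms(1) by (cases t) (auto simp: admissible_def)
  have "x_event p \<inter> x_event j = {}"
    using assms(2) t by (intro x_event_disjoint) auto
  then have "x_event p \<inter> y_event q \<in> events" "(x_event p \<inter> y_event q) \<inter> x_event j = {}"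
    using assms x_event_in_events y_event_in_events by auto
  from prob_cf_event_single_Int_bounds[OF t(2,3) this]
  show "lower_xy C {t} p q \<le> prob (cf_event {t} \<inter> (x_event p \<inter> y_event q))"
    and "prob (cf_event {t} \<inter> (x_event p \<inter> y_event q)) \<le> upper_xy C {t} p q"
    by (simp_all add: t(1) lower_xy.simps upper_xy.simps pr_xy_eq)
qed

text \<open>The bound for \<open>lower\<close> on the smaller sets is a premise, so that the lemma
  can be applied inside the induction that proves \<open>lower_le\<close>. The condition on
  \<open>card S\<close> limits it to the case where S - {t} is nonempty.\<close>

lemma lower_x_le:
  assumes S: "admissible S" and p: "p \<in> {1..num_x C} - snd ` S"
    and IH: "\<And>t. t \<in> S \<Longrightarrow> 2 \<le> card S \<Longrightarrow> lower C (S - {t}) \<le> prob (cf_event (S - {t}))"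
  shows "lower_x C S p \<le> prob (cf_event S \<inter> x_event p)"
proof (cases "2 \<le> card S")
  case True
  have p': "x_event p \<in> events" using p x_event_in_events by blast
  have "lower C (S - {t}) + lower_x C {t} p - 1 \<le> prob (cf_event S \<inter> x_event p)"
    if t: "t \<in> S" for t
    using IH[OF t True] prob_cf_event_Int_ge_Diff[OF S True t p']
      x_event_single_bounds(1)[of t p] admissible_subset[OF S, of "{t}"] t p
    by fastforce
  moreover have "S \<noteq> {}" using True by auto
  ultimately show ?thesis
    using True admissible_finite[OF S] prob_cf_event_Int_ge_sum[OF S p']
    by (simp add: lower_x.simps[of C S] pr_x_eq)
next
  case False
  with S obtain t where "S = {t}" by (rule admissible_singletonE)
  then show ?thesis using x_event_single_bounds S p by simp
qed

lemma lower_xy_le: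
  assumes S: "admissible S" and p: "p \<in> {1..num_x C} - snd ` S" and q: "q \<in> {1..num_y C}"
    and IH: "\<And>t. t \<in> S \<Longrightarrow> 2 \<le> card S \<Longrightarrow> lower C (S - {t}) \<le> prob (cf_event (S - {t}))"
  shows "lower_xy C S p q \<le> prob (cf_event S \<inter> (x_event p \<inter> y_event q))"
proof (cases "2 \<le> card S")
  case True
  have B: "x_event p \<inter> y_event q \<in> events"
    using p q x_event_in_events y_event_in_events by blast
  have "lower C (S - {t}) + lower_xy C {t} p q - 1 \<le> prob (cf_event S \<inter> (x_event p \<inter> y_event q))"
    if t: "t \<in> S" for t
    using IH[OF t True] prob_cf_event_Int_ge_Diff[OF S True t B]
      xy_event_single_bounds(1)[of t p q] admissible_subset[OF S, of "{t}"] t p q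
    by fastforce
  moreover have "S \<noteq> {}" using True by auto
  ultimately show ?thesis
    using True admissible_finite[OF S] prob_cf_event_Int_ge_sum[OF S B]
    by (simp add: lower_xy.simps[of C S] pr_xy_eq)
next
  case False
  with S obtain t where "S = {t}" by (rule admissible_singletonE)
  then show ?thesis using xy_event_single_bounds S p q by simp
qed

lemma prob_cf_event_Int_le_MIN_pr_cf:
  assumes S: "admissible S" and B: "B \<in> events"
  shows "prob (cf_event S \<inter> B) \<le> (MIN (i, j)\<in>S. pr_cf C i j)"
proof -
  have "prob (cf_event S \<inter> B) \<le> prob (cf_event {t})" if "t \<in> S" for t
    using prob_cf_event_Int_le[OF admissible_subset[OF S] B, of "{t}"] that by simp
  moreover have "S \<noteq> {}" using S by (simp add: admissible_def)
  ultimately show ?thesis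
    using admissible_finite[OF S] by (simp add: pr_cf_eq case_prod_unfold)
qed

text \<open>In the recursive case every entry of the minimum is, or bounds from above, the
  probability of an event containing this one, so monotonicity suffices.\<close>

lemma le_upper_x:
  assumes S: "admissible S" and p: "p \<in> {1..num_x C} - snd ` S"
    and IH: "\<And>t. t \<in> S \<Longrightarrow> 2 \<le> card S \<Longrightarrow> prob (cf_event (S - {t})) \<le> upper C (S - {t})"
  shows "prob (cf_event S \<inter> x_event p) \<le> upper_x C S p"
proof (cases "2 \<le> card S")
  case True
  let ?B = "x_event p"
  have B: "?B \<in> events" using p x_event_in_events by blast
  have "prob (cf_event S \<inter> ?B) \<le> upper C (S - {t})" if t: "t \<in> S" for t
    using prob_cf_event_Int_le[OF admissible_Diff[OF S True] B, of t S] IH[OF t True] by auto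
  moreover have "prob (cf_event S \<inter> ?B) \<le> upper_x C {t} p" if t: "t \<in> S" for t
    using prob_cf_event_Int_mono[OF admissible_subset[OF S] B, of "{t}" S]
      x_event_single_bounds(2)[of t p] admissible_subset[OF S, of "{t}"] t p
    by fastforce
  moreover have "prob (cf_event S \<inter> ?B) \<le> pr_x C p"
    using B by (auto simp: pr_x_eq intro: finite_measure_mono)
  moreover have "S \<noteq> {}" using True by auto
  ultimately show ?thesis
    using True admissible_finite[OF S] prob_cf_event_Int_le_MIN_pr_cf[OF S B]
    by (simp add: upper_x.simps[of C S])
next
  case False
  with S obtain t where "S = {t}" by (rule admissible_singletonE)
  then show ?thesis using x_event_single_bounds S p by simp
qed

lemma le_upper_xy:
  assumes S: "admissible S" and p: "p \<in> {1..num_x C} - snd ` S" and q: "q \<in> {1..num_y C}"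
    and IH: "\<And>t. t \<in> S \<Longrightarrow> 2 \<le> card S \<Longrightarrow> prob (cf_event (S - {t})) \<le> upper C (S - {t})"
  shows "prob (cf_event S \<inter> (x_event p \<inter> y_event q)) \<le> upper_xy C S p q"
proof (cases "2 \<le> card S")
  case True
  let ?B = "x_event p \<inter> y_event q"
  have B: "?B \<in> events"
    using p q x_event_in_events y_event_in_events by blast
  have "prob (cf_event S \<inter> ?B) \<le> upper C (S - {t})" if t: "t \<in> S" for t
    using prob_cf_event_Int_le[OF admissible_Diff[OF S True] B, of t S] IH[OF t True] by auto
  moreover have "prob (cf_event S \<inter> ?B) \<le> upper_xy C {t} p q" if t: "t \<in> S" for t
    using prob_cf_event_Int_mono[OF admissible_subset[OF S] B, of "{t}" S]
      xy_event_single_bounds(2)[of t p q] admissible_subset[OF S, of "{t}"] t p q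
    by fastforce
  moreover have "prob (cf_event S \<inter> ?B) \<le> pr_xy C p q"
    using B by (auto simp: pr_xy_eq intro: finite_measure_mono)
  moreover have "S \<noteq> {}" using True by auto
  ultimately show ?thesis
    using True admissible_finite[OF S] prob_cf_event_Int_le_MIN_pr_cf[OF S B]
    by (simp add: upper_xy.simps[of C S])
next
  case False
  with S obtain t where "S = {t}" by (rule admissible_singletonE)
  then show ?thesis using xy_event_single_bounds S p q by simp
qed

section \<open>Validity of L(S) and U(S)\<close>

lemma lower_le:
  assumes "admissible S"
  shows "lower C S \<le> prob (cf_event S)"
  using assms
proof (induction "card S" arbitrary: S rule: less_induct)
  case less
  note S = less.prems
  show ?case
  proof (cases "2 \<le> card S")
    case True
    \<comment> \<open>Two instances are needed: T = S for the call of \<open>lower_x\<close> at S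
      itself, and T = S - {r} for the calls of \<open>lower_xy\<close> at S - {r}. Thus an induction
      on \<open>lower\<close> alone handles the mutual recursion.\<close>
    have IH: "lower C (T - {t}) \<le> prob (cf_event (T - {t}))"
      if "admissible T" "card T \<le> card S" "t \<in> T" "2 \<le> card T" for T t
      using that admissible_finite[OF that(1)]
      by (intro less.hyps admissible_Diff) (simp_all add: card_Diff_singleton)
    have fin: "finite S" "S \<noteq> {}" using True admissible_finite[OF S] by auto
    \<comment> \<open>The general bounds are used with B the whole space, whose probability 1 is the
      \<open>+ 1\<close> in the next inequality.\<close>
    have space: "cf_event S \<inter> space (meas C) = cf_event S" for S
      by (auto simp: cf_event_def)
    have "(\<Sum>(i, j)\<in>S. pr_cf C i j) - real (card S) + 1 \<le> prob (cf_event S)"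
      using prob_cf_event_Int_ge_sum[OF S sets.top] by (simp add: space prob_space)
    moreover have "lower C (S - {t}) + pr_cf C (fst t) (snd t) - 1 \<le> prob (cf_event S)"
      if t: "t \<in> S" for t
      using prob_cf_event_Int_ge_Diff[OF S True t sets.top] IH[OF S order.refl t True]
      by (simp add: space pr_cf_eq)
    moreover have "(\<Sum>r\<in>S. lower_xy C (S - {r}) (snd r) (fst r)) +
        (\<Sum>p\<in>{1..num_x C} - snd ` S. lower_x C S p) \<le> prob (cf_event S)"
    proof -
      have "lower_xy C (S - {r}) (snd r) (fst r)
          \<le> prob (cf_event (S - {r}) \<inter> (x_event (snd r) \<inter> y_event (fst r)))" if r: "r \<in> S" for r
      proof (rule lower_xy_le[OF admissible_Diff[OF S True]])
        show "snd r \<in> {1..num_x C} - snd ` (S - {r})"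
          using admissible_snd_notin_Diff[OF S r] admissible_snd_subset[OF S] r by blast
        show "fst r \<in> {1..num_y C}"
          using S r by (auto simp: admissible_def)
      qed (use IH[OF admissible_Diff[OF S True]] fin r in \<open>simp add: card_Diff_singleton\<close>)
      moreover have "lower_x C S p \<le> prob (cf_event S \<inter> x_event p)"
        if "p \<in> {1..num_x C} - snd ` S" for p
        using lower_x_le[OF S that IH[OF S order.refl]] .
      ultimately show ?thesis
        unfolding prob_cf_event_eq[OF S] by (intro add_mono sum_mono) auto
    qed
    ultimately show ?thesis
      using True fin by (simp add: lower.simps[of C S])
  next
    case False
    with S obtain i j where "S = {(i, j)}" by (metis admissible_singletonE surj_pair)
    then show ?thesis by (simp add: lower.simps pr_cf_eq)
  qed
qed

lemma le_upper:
  assumes "admissible S"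
  shows "prob (cf_event S) \<le> upper C S"
  using assms
proof (induction "card S" arbitrary: S rule: less_induct)
  case less
  note S = less.prems
  show ?case
  proof (cases "2 \<le> card S")
    case True
    have IH: "prob (cf_event (T - {t})) \<le> upper C (T - {t})"
      if "admissible T" "card T \<le> card S" "t \<in> T" "2 \<le> card T" for T t
      using that admissible_finite[OF that(1)]
      by (intro less.hyps admissible_Diff) (simp_all add: card_Diff_singleton)
    have fin: "finite S" "S \<noteq> {}" using True admissible_finite[OF S] by auto
    have space: "cf_event S \<inter> space (meas C) = cf_event S"
      by (auto simp: cf_event_def)
    have "prob (cf_event S) \<le> upper C (S - {t})" if t: "t \<in> S" for t
      using prob_cf_event_Int_le[OF admissible_Diff[OF S True] sets.top, of t S]
        IH[OF S order.refl t True]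
      by (auto simp: space)
    moreover have "prob (cf_event S) \<le> (\<Sum>r\<in>S. upper_xy C (S - {r}) (snd r) (fst r)) +
        (\<Sum>p\<in>{1..num_x C} - snd ` S. upper_x C S p)"
    proof -
      have "prob (cf_event (S - {r}) \<inter> (x_event (snd r) \<inter> y_event (fst r)))
          \<le> upper_xy C (S - {r}) (snd r) (fst r)" if r: "r \<in> S" for r
      proof (rule le_upper_xy[OF admissible_Diff[OF S True]])
        show "snd r \<in> {1..num_x C} - snd ` (S - {r})"
          using admissible_snd_notin_Diff[OF S r] admissible_snd_subset[OF S] r by blast
        show "fst r \<in> {1..num_y C}"
          using S r by (auto simp: admissible_def)
      qed (use IH[OF admissible_Diff[OF S True]] fin r in \<open>simp add: card_Diff_singleton\<close>)
      moreover have "prob (cf_event S \<inter> x_event p) \<le> upper_x C S p"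
        if "p \<in> {1..num_x C} - snd ` S" for p
        using le_upper_x[OF S that IH[OF S order.refl]] .
      ultimately show ?thesis
        unfolding prob_cf_event_eq[OF S] by (intro add_mono sum_mono) auto
    qed
    ultimately show ?thesis
      using True fin prob_cf_event_Int_le_MIN_pr_cf[OF S sets.top]
      by (simp add: upper.simps[of C S] space)
  next
    case False
    with S obtain i j where "S = {(i, j)}" by (metis admissible_singletonE surj_pair)
    then show ?thesis by (simp add: upper.simps pr_cf_eq)
  qed
qed

section \<open>Joint bounds with Y = y_q\<close>

lemma cf_y_bounds:
  assumes ij: "i \<in> {1..num_y C}" "j \<in> {1..num_x C}" and q: "q \<in> {1..num_y C}"
  shows "lower_cf_y C i j q \<le> prob (cf_event {(i, j)} \<inter> y_event q)"
    and "prob (cf_event {(i, j)} \<inter> y_event q) \<le> upper_cf_y C i j q"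
proof -
  let ?E = "cf_event {(i, j)}"
  have adm: "admissible {(i, j)}" using ij by (auto simp: admissible_def)
  have E: "?E \<in> events" and Y: "y_event q \<in> events" and X: "x_event j \<in> events"
    using adm ij q cf_event_in_events y_event_in_events x_event_in_events by auto
  have bonf: "pr_cf C i j + pr_y C q - 1 \<le> prob (?E \<inter> y_event q)"
    using prob_cf_event_Int_ge_sum[OF adm Y] by (simp add: pr_y_eq)
  have EX: "?E \<inter> x_event j = x_event j \<inter> y_event i"
    using cf_event_Int_x_event[OF adm, of "(i, j)"] by (auto simp: cf_event_def x_event_def)
  have XYE: "x_event j \<inter> y_event i \<subseteq> ?E" using EX by blast
  show "lower_cf_y C i j q \<le> prob (?E \<inter> y_event q)"
  proof (cases "i = q")
    case True
    have "pr_xy C j i \<le> prob (?E \<inter> y_event q)"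
      unfolding pr_xy_eq using True XYE E Y by (intro finite_measure_mono) auto
    then show ?thesis using True bonf by (simp add: lower_cf_y_def)
  next
    case False
    \<comment> \<open>The summands are the singleton values of \<open>lower_xy\<close>. Since i
      differs from q, X = x_j contributes nothing to the decomposition, and the remaining p add up
      to the full probability.\<close>
    have "(\<Sum>p\<in>{1..num_x C} - {j}. max 0 (pr_cf C i j + pr_xy C p q - 1 + pr_x C j - pr_xy C j i))
        \<le> (\<Sum>p\<in>{1..num_x C} - {j}. prob (?E \<inter> (x_event p \<inter> y_event q)))"
      using xy_event_single_bounds(1)[OF adm _ q]
      by (intro sum_mono) (simp add: lower_xy.simps)
    also have "\<dots> = prob (?E \<inter> y_event q)"
    proof -
      have "{r. r = (i, j) \<and> fst r = q} = {}" using False by auto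
      then show ?thesis using prob_cf_event_y_event_eq[OF adm q] by simp
    qed
    finally show ?thesis using False bonf by (simp add: lower_cf_y_def)
  qed
  show "prob (?E \<inter> y_event q) \<le> upper_cf_y C i j q"
  proof (cases "i = q")
    case True
    then show ?thesis
      using E Y by (auto simp: upper_cf_y_def pr_cf_eq pr_y_eq intro!: finite_measure_mono)
  next
    case False
    \<comment> \<open>Inside X = x_j the event forces Y = y_i, which excludes Y = y_q. The part of Y
      = y_q outside X = x_j can thus serve as B in the single-pair bound.\<close>
    have eq: "?E \<inter> y_event q = ?E \<inter> (y_event q - x_event j)"
      using EX y_event_disjoint[OF ij(1) q False] by blast
    have "prob (y_event q - x_event j) = pr_y C q - pr_xy C j q"
      using finite_measure_Diff'[OF Y X] by (simp add: pr_y_eq pr_xy_eq Int_commute)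
    then show ?thesis
      using prob_cf_event_single_Int_bounds(2)[OF ij, of "y_event q - x_event j"] X Y False eq
      by (auto simp: upper_cf_y_def)
  qed
qed

end

theorem theorem10:
  fixes C :: "('w, 'x, 'y) counterfactuals"
    and k q :: nat
    and i j :: "nat \<Rightarrow> nat"
    and S :: "(nat \<times> nat) set"
  assumes model: "counterfactual_model C"
    and k: "2 \<le> k"
    and i: "\<And>t. t \<in> {1..k} \<Longrightarrow> i t \<in> {1..num_y C}"
    and q: "q \<in> {1..num_y C}"
    and j: "\<And>t. t \<in> {1..k} \<Longrightarrow> j t \<in> {1..num_x C}"
    and j_distinct: "inj_on j {1..k}"
    and S: "S = (\<lambda>t. (i t, j t)) ` {1..k}"
  shows "\<P>(w in meas C. (\<forall>t\<in>{1..k}. cf C (xval C (j t)) w = yval C (i t)) \<and> eff C w = yval C q)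
        \<ge> Max {0,
             (\<Sum>t=1..k. pr_cf C (i t) (j t)) + pr_y C q - real k,
             MAX t\<in>{1..k}. lower C (S - {(i t, j t)}) + lower_cf_y C (i t) (j t) q - 1,
             (\<Sum>r | r \<in> {1..k} \<and> i r = q. lower_xy C (S - {(i r, j r)}) (j r) (i r)) +
               (\<Sum>p\<in>{1..num_x C} - j ` {1..k}. lower_xy C S p q)}
       \<and> \<P>(w in meas C. (\<forall>t\<in>{1..k}. cf C (xval C (j t)) w = yval C (i t)) \<and> eff C w = yval C q)
        \<le> Min {MIN t\<in>{1..k}. pr_cf C (i t) (j t),
             pr_y C q,
             MIN t\<in>{1..k}. upper C (S - {(i t, j t)}),
             MIN t\<in>{1..k}. upper_cf_y C (i t) (j t) q,
             (\<Sum>r | r \<in> {1..k} \<and> i r = q. upper_xy C (S - {(i r, j r)}) (j r) (i r)) +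
               (\<Sum>p\<in>{1..num_x C} - j ` {1..k}. upper_xy C S p q)}"
proof -
  interpret counterfactual_model C by (rule model)
  let ?f = "\<lambda>t. (i t, j t)"
  have inj: "inj_on ?f {1..k}"
    using j_distinct unfolding inj_on_def by blast
  have card: "card S = k" using card_image[OF inj] by (simp add: S)
  have two: "2 \<le> card S" using card k by simp
  have snd_S: "snd ` S = j ` {1..k}" by (simp add: S image_image)
  have adm: "admissible S"
    unfolding admissible_def
  proof (intro conjI)
    show "S \<noteq> {}" using two by auto
    show "S \<subseteq> {1..num_y C} \<times> {1..num_x C}"
      unfolding S by (intro image_subsetI SigmaI i j)
    show "inj_on snd S"
      unfolding S using j_distinct by (intro inj_on_imageI) (simp add: comp_def)
  qed
  have mem: "?f t \<in> S" if "t \<in> {1..k}" for t using that unfolding S by (rule imageI)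
  have Y: "y_event q \<in> events" using q by (rule y_event_in_events)
  let ?P = "prob (cf_event S \<inter> y_event q)"
  have P: "\<P>(w in meas C. (\<forall>t\<in>{1..k}. cf C (xval C (j t)) w = yval C (i t)) \<and> eff C w = yval C q) = ?P"
    by (rule arg_cong[where f = prob]) (auto simp: cf_event_def y_event_def S)
  \<comment> \<open>Distinctness of the j_t makes t \<mapsto> (i_t, j_t) injective, so sums over
    pairs and over positions agree even when effect indices repeat.\<close>
  have reindex: "(\<Sum>r | r \<in> S \<and> fst r = q. g r) = (\<Sum>r | r \<in> {1..k} \<and> i r = q. g (i r, j r))"
    for g :: "nat \<times> nat \<Rightarrow> real"
  proof -
    have "{r. r \<in> S \<and> fst r = q} = ?f ` {r. r \<in> {1..k} \<and> i r = q}"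
      by (auto simp: S)
    moreover have "inj_on ?f {r. r \<in> {1..k} \<and> i r = q}"
      using inj by (rule inj_on_subset) auto
    ultimately show ?thesis by (simp only: sum.reindex comp_def)
  qed
  have decomp: "?P =
      (\<Sum>r | r \<in> {1..k} \<and> i r = q.
        prob (cf_event (S - {(i r, j r)}) \<inter> (x_event (j r) \<inter> y_event (i r)))) +
      (\<Sum>p\<in>{1..num_x C} - j ` {1..k}. prob (cf_event S \<inter> (x_event p \<inter> y_event q)))"
    using prob_cf_event_y_event_eq[OF adm q] by (simp add: reindex snd_S)
  have adm_Diff: "admissible (S - {t})" for t
    using admissible_Diff[OF adm two] .
  \<comment> \<open>\<open>lower_xy_le\<close> and \<open>le_upper_xy\<close> at S - {t} ask for the
    bounds on sets with one more pair removed.\<close>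
  have adm_Diff2: "admissible (S - {t} - {s})" if "2 \<le> card (S - {t})" for s t
    using admissible_Diff[OF adm_Diff that] .
  have notin: "j r \<in> {1..num_x C} - snd ` (S - {(i r, j r)})" if "r \<in> {1..k}" for r
    using admissible_snd_notin_Diff[OF adm mem[OF that]] j[OF that] by simp
  have sum_pr: "(\<Sum>t=1..k. pr_cf C (i t) (j t)) = (\<Sum>(i, j)\<in>S. pr_cf C i j)"
    using inj by (simp add: S sum.reindex)

  have "(\<Sum>t=1..k. pr_cf C (i t) (j t)) + pr_y C q - real k \<le> ?P"
    using prob_cf_event_Int_ge_sum[OF adm Y] unfolding sum_pr card pr_y_eq .
  moreover have "lower C (S - {(i t, j t)}) + lower_cf_y C (i t) (j t) q - 1 \<le> ?P"
    if t: "t \<in> {1..k}" for t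
    using prob_cf_event_Int_ge_Diff[OF adm two mem[OF t] Y] lower_le[OF adm_Diff[of "?f t"]]
      cf_y_bounds(1)[OF i[OF t] j[OF t] q]
    by linarith
  moreover have "(\<Sum>r | r \<in> {1..k} \<and> i r = q. lower_xy C (S - {(i r, j r)}) (j r) (i r)) +
      (\<Sum>p\<in>{1..num_x C} - j ` {1..k}. lower_xy C S p q) \<le> ?P"
    \<comment> \<open>The exact decomposition has the same index sets as the bound, so the two are
      compared summand by summand.\<close>
    unfolding decomp snd_S[symmetric]
    by (intro add_mono sum_mono lower_xy_le adm adm_Diff notin i q lower_le adm_Diff2) simp_all
  moreover have "?P \<le> pr_cf C (i t) (j t)" if t: "t \<in> {1..k}" for t
    using prob_cf_event_Int_le[OF admissible_subset[OF adm] Y, of "{?f t}" S] mem[OF t]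
    by (simp add: pr_cf_eq)
  moreover have "?P \<le> pr_y C q"
    using Y by (auto simp: pr_y_eq intro: finite_measure_mono)
  moreover have "?P \<le> upper C (S - {(i t, j t)})" for t
    using order.trans[OF prob_cf_event_Int_le[OF adm_Diff Y Diff_subset] le_upper[OF adm_Diff]] .
  moreover have "?P \<le> upper_cf_y C (i t) (j t) q" if t: "t \<in> {1..k}" for t
  proof (rule order.trans)
    show "?P \<le> prob (cf_event {?f t} \<inter> y_event q)"
      using mem[OF t] by (intro prob_cf_event_Int_mono admissible_subset[OF adm] Y) simp_all
    show "\<dots> \<le> upper_cf_y C (i t) (j t) q"
      using cf_y_bounds(2)[OF i[OF t] j[OF t] q] .
  qed
  moreover have "?P \<le> (\<Sum>r | r \<in> {1..k} \<and> i r = q. upper_xy C (S - {(i r, j r)}) (j r) (i r)) +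
      (\<Sum>p\<in>{1..num_x C} - j ` {1..k}. upper_xy C S p q)"
    unfolding decomp snd_S[symmetric]
    by (intro add_mono sum_mono le_upper_xy adm adm_Diff notin i q le_upper adm_Diff2) simp_all
  moreover have "{1..k} \<noteq> {}" using k by auto
  ultimately show ?thesis
    unfolding P
    \<comment> \<open>Both bounds split into one inequality per entry; the inner maxima and minima
      over t need {1..k} to be finite and nonempty.\<close>
    by (simp only: Max_le_iff Min_ge_iff finite.intros finite_imageI finite_atLeastAtMost
        image_is_empty insert_not_empty Set.ball_simps measure_nonneg simp_thms) blast
qed

end
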